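(* Let $c>0$ and $\delta<0$ be real constants and let $F$ be the distribution function of a non-degenerate integrable real random variable, with $G=1-F$. Then $F\in\mathbf{P}_{c,\delta}$ if and only if the following two conditions hold: (a) $\mathrm{supp}(F)=\{a_n:n\ge 0\}$, where $(a_n)_{n\ge0}$ is a strictly increasing sequence with $a_0=\alpha_F$ and $a_{n+1}-a_n\ge|\delta|$ for all $n\ge0$ (in particular, $\omega_F=\infty$); (b) $$G(a_n)=\prod_{i=0}^{n}\frac{1}{1+c(a_{i+1}-a_i)},\qquad n\ge0.$$
   Context: Let $(X_n)_{n\ge1}$ be independent, identically distributed, integrable real random variables with non-degenerate distribution function $F$, and let $G=1-F$. Put $\mathcal{F}_n=\sigma(X_1,\ldots,X_n)$ and $M_n=\max\{X_1,\ldots,X_n\}$. For a real $\delta\neq0$ let $I_1=1$ and, for $n\ge2$, let $I_n=1$ if $X_n>M_{n-1}+\delta$ and $I_n=0$ otherwise; let $N_n=\sum_{k=1}^n I_k$ (the number of $\delta$-records among the first $n$ observations). For real $c>0$ and $\delta\ne0$, write $F\in\mathbf{P}_{c,\delta}$ if $F$ is such a (non-degenerate, finite-mean) distribution function and $(N_n-cM_n)_{n\ge1}$ is an $(\mathcal{F}_n)$-martingale. The support is $\mathrm{supp}(F)=\{x\in\mathbb{R}:F(x+\epsilon)-F(x-\epsilon)>0\ \forall\epsilon>0\}$; $\alpha_F=\inf\mathrm{supp}(F)$ and $\omega_F=\sup\mathrm{supp}(F)$ (possibly infinite). *)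

theory Defs
  imports "HOL-Probability.Probability"
begin

(* Sequences are indexed by n \<ge> 1, as usual for records; the values at index 0 (X 0, the
   empty maximum, ...) play no role. The distribution function is x \<mapsto> P(X \<le> x), i.e. cdf. *)
definition iid_integrable ::
    "'a measure \<Rightarrow> (nat \<Rightarrow> 'a \<Rightarrow> real) \<Rightarrow> (real \<Rightarrow> real) \<Rightarrow> bool" where
  "iid_integrable M X F \<longleftrightarrow>
     prob_space M \<and>
     prob_space.indep_vars M (\<lambda>_. borel) X {1..} \<and>
     (\<forall>n\<ge>1. cdf (distr M borel (X n)) = F) \<and>
     (\<forall>n\<ge>1. integrable M (X n))"

definition degenerate :: "(real \<Rightarrow> real) \<Rightarrow> bool" where
  "degenerate F \<longleftrightarrow> (\<exists>x. \<forall>t. F t = (if x \<le> t then 1 else 0))"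

definition run_max :: "(nat \<Rightarrow> 'a \<Rightarrow> real) \<Rightarrow> nat \<Rightarrow> 'a \<Rightarrow> real" where
  "run_max X n \<omega> = Max ((\<lambda>k. X k \<omega>) ` {1..n})"

definition delta_record :: "(nat \<Rightarrow> 'a \<Rightarrow> real) \<Rightarrow> real \<Rightarrow> nat \<Rightarrow> 'a \<Rightarrow> nat" where
  "delta_record X \<delta> n \<omega> =
     (if n = 1 then 1 else if X n \<omega> > run_max X (n - 1) \<omega> + \<delta> then 1 else 0)"

definition num_delta_records :: "(nat \<Rightarrow> 'a \<Rightarrow> real) \<Rightarrow> real \<Rightarrow> nat \<Rightarrow> 'a \<Rightarrow> nat" where
  "num_delta_records X \<delta> n \<omega> = (\<Sum>k=1..n. delta_record X \<delta> k \<omega>)"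

definition nat_filtration ::
    "'a measure \<Rightarrow> (nat \<Rightarrow> 'a \<Rightarrow> real) \<Rightarrow> nat \<Rightarrow> 'a measure" where
  "nat_filtration M X n =
     sigma (space M) (\<Union>k\<in>{1..n}. {X k -` B \<inter> space M | B. B \<in> sets borel})"

definition martingale_from_1 ::
    "'a measure \<Rightarrow> (nat \<Rightarrow> 'a measure) \<Rightarrow> (nat \<Rightarrow> 'a \<Rightarrow> real) \<Rightarrow> bool" where
  "martingale_from_1 M \<F> Z \<longleftrightarrow>
     filtration (space M) \<F> \<and>
     (\<forall>n\<ge>1. subalgebra M (\<F> n) \<and>
            Z n \<in> borel_measurable (\<F> n) \<and>
            integrable M (Z n) \<and>
            (AE \<omega> in M. real_cond_exp M (\<F> n) (Z (n + 1)) \<omega> = Z n \<omega>))"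

(* The class P_{c,delta}, read off a given i.i.d. sequence X on M. Membership depends only on F,
   since the martingale property depends only on the law of the sequence. *)
definition P_class ::
    "'a measure \<Rightarrow> (nat \<Rightarrow> 'a \<Rightarrow> real) \<Rightarrow> real \<Rightarrow> real \<Rightarrow> (real \<Rightarrow> real) set" where
  "P_class M X c \<delta> =
     {F. iid_integrable M X F \<and> \<not> degenerate F \<and>
         martingale_from_1 M (nat_filtration M X)
           (\<lambda>n \<omega>. real (num_delta_records X \<delta> n \<omega>) - c * run_max X n \<omega>)}"

definition supp :: "(real \<Rightarrow> real) \<Rightarrow> real set" where
  "supp F = {x. \<forall>\<epsilon>>0. F (x + \<epsilon>) - F (x - \<epsilon>) > 0}"

(* Extended reals, since the support may be unbounded. *)
definition left_end :: "(real \<Rightarrow> real) \<Rightarrow> ereal" where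
  "left_end F = Inf (ereal ` supp F)"

definition right_end :: "(real \<Rightarrow> real) \<Rightarrow> ereal" where
  "right_end F = Sup (ereal ` supp F)"

definition cond_a :: "(real \<Rightarrow> real) \<Rightarrow> real \<Rightarrow> (nat \<Rightarrow> real) \<Rightarrow> bool" where
  "cond_a F \<delta> a \<longleftrightarrow>
     supp F = range a \<and> strict_mono a \<and> ereal (a 0) = left_end F \<and>
     (\<forall>n. a (n + 1) - a n \<ge> \<bar>\<delta>\<bar>)"

definition cond_b :: "(real \<Rightarrow> real) \<Rightarrow> real \<Rightarrow> (nat \<Rightarrow> real) \<Rightarrow> bool" where
  "cond_b F c a \<longleftrightarrow>
     (\<forall>n. 1 - F (a n) = (\<Prod>i=0..n. 1 / (1 + c * (a (i + 1) - a i))))"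

end

theory Submission
  imports Defs
begin

text \<open>
  Let \<open>\<mu>\<close> be the common law of the \<open>X n\<close>, with tail \<open>G(x) = \<mu>(x,\<infinity>)\<close> and stop-loss transform
  \<open>h(x) = E (X - x)\<^sup>+\<close>. Since \<open>X (n+1)\<close> is independent of the past, the conditional drift of
  \<open>N - c M\<close> from time \<open>n\<close> to \<open>n + 1\<close> is \<open>G(M n + \<delta>) - c h(M n)\<close>. It vanishes for \<open>n = 1\<close> iff \<open>\<mu>\<close>-almost
  every \<open>x\<close> is \<^emph>\<open>balanced\<close>, i.e. satisfies \<open>G(x + \<delta>) = c h(x)\<close>; and as \<open>M n\<close> is one of the observations,
  it then vanishes for all \<open>n\<close> (\<open>martingale_iff_balanced\<close>). What remains is a statement about \<open>\<mu>\<close> alone.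

  Suppose almost every point is balanced. No \<open>b\<close> has \<open>G(b) = 0\<close>, for otherwise \<open>h(x) \<le> (b - x) G(x)\<close>
  shows that no mass lies just below \<open>b\<close> either, and \<open>G\<close> would vanish down to \<open>-\<infinity>\<close>
  (\<open>balanced_unbounded\<close>). Balanced points are bounded below, because \<open>G \<le> 1\<close> while \<open>h(x) \<rightarrow> \<infinity>\<close> as
  \<open>x \<rightarrow> -\<infinity>\<close>. They are moreover \<open>\<bar>\<delta>\<bar>\<close>-separated (\<open>balanced_separated\<close>): for balanced \<open>x < y\<close> the mass of
  \<open>(x + \<delta>, y + \<delta>]\<close> is \<open>c (h(x) - h(y)) > 0\<close>, so this interval contains a balanced point; if
  \<open>y - x < \<bar>\<delta>\<bar>\<close> that point and \<open>x\<close> form another pair that is too close, and repeating this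
  produces balanced points arbitrarily far to the left. Hence the set of balanced points is closed
  and discrete, contains the support, and the support is an increasing sequence as in (a).

  Once (a) holds, \<open>G\<close> is constant between consecutive support points, whence \<open>G(a n + \<delta>) = G(a (n-1))\<close>
  (with value \<open>1\<close> for \<open>n = 0\<close>) and \<open>h(a n) - h(a (n+1)) = (a (n+1) - a n) G(a n)\<close>. Differences of the
  equations \<open>G(a n + \<delta>) = c h(a n)\<close> are therefore the recursion
  \<open>G(a (n-1)) = G(a n) (1 + c (a (n+1) - a n))\<close>, which is (b). Conversely the recursion
  makes \<open>G(a n + \<delta>) - c h(a n)\<close> independent of \<open>n\<close>, and both terms tend to \<open>0\<close>
  (\<open>cond_b_iff_balanced\<close>).
\<close>

section \<open>Tail and stop-loss transform of an integrable law\<close>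

locale integrable_law = real_distribution \<mu> for \<mu> :: "real measure" +
  assumes integrable_id: "integrable \<mu> (\<lambda>t. t)"
begin

definition tail :: "real \<Rightarrow> real" where
  "tail x = prob {x<..}"

definition stop_loss :: "real \<Rightarrow> real" where
  "stop_loss x = (\<integral>t. max 0 (t - x) \<partial>\<mu>)"

lemma tail_eq_cdf: "tail x = 1 - cdf \<mu> x"
proof -
  have "prob (space \<mu> - {..x}) = 1 - prob {..x}"
    by (rule prob_compl) simp
  moreover have "space \<mu> - {..x} = {x<..}"
    by auto
  ultimately show ?thesis
    by (simp add: tail_def cdf_def)
qed

lemma tail_antimono: "x \<le> y \<Longrightarrow> tail y \<le> tail x"
  by (simp add: tail_eq_cdf cdf_nondecreasing)

lemma tail_bounds: "0 \<le> tail x" "tail x \<le> 1"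
  by (simp_all add: tail_def)

lemma tail_diff: "x < y \<Longrightarrow> tail x - tail y = prob {x<..y}"
  by (simp add: tail_eq_cdf cdf_diff_eq)

lemma tail_tendsto_at_top: "(tail \<longlongrightarrow> 0) at_top"
  using tendsto_diff[OF tendsto_const cdf_lim_at_top_prob, of 1] by (simp add: tail_eq_cdf[abs_def])

lemma tail_tendsto_at_bot: "(tail \<longlongrightarrow> 1) at_bot"
  using tendsto_diff[OF tendsto_const cdf_lim_at_bot, of 1] by (simp add: tail_eq_cdf[abs_def])

lemma integrable_excess [simp]: "integrable \<mu> (\<lambda>t. max 0 (t - x))"
  by (intro integrable_max) (simp_all add: integrable_id)

lemma integral_indicator_tail: "(\<integral>t. k * indicator {x<..} t \<partial>\<mu>) = k * tail x"
  by (simp add: tail_def)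

lemma stop_loss_diff: "stop_loss x - stop_loss y = (\<integral>t. max 0 (t - x) - max 0 (t - y) \<partial>\<mu>)"
  unfolding stop_loss_def by (rule Bochner_Integration.integral_diff[symmetric]) auto

lemma integrable_indicator_tail [simp]: "integrable \<mu> (\<lambda>t. k * indicator {x<..} t :: real)"
  by (intro integrable_mult_right integrable_real_indicator) (simp_all add: less_top[symmetric])

text \<open>
  The difference \<open>h(x) - h(y)\<close> is the integral of \<open>G\<close> over \<open>[x, y]\<close>. A lower bound, and its value when \<open>\<mu>\<close> has
  no mass inside the interval, follow already from comparing \<open>(t - x)\<^sup>+ - (t - y)\<^sup>+\<close> with \<open>y - x\<close> times an
  indicator.
\<close>

lemma stop_loss_diff_ge:
  assumes "x \<le> y"
  shows "(y - x) * tail y \<le> stop_loss x - stop_loss y"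
proof -
  have "(\<integral>t. (y - x) * indicator {y<..} t \<partial>\<mu>) \<le> (\<integral>t. max 0 (t - x) - max 0 (t - y) \<partial>\<mu>)"
    using assms
    by (intro integral_mono Bochner_Integration.integrable_diff integrable_indicator_tail
        integrable_excess) (auto simp: indicator_def max_def)
  then show ?thesis
    by (simp only: stop_loss_diff integral_indicator_tail)
qed

lemma stop_loss_antimono: "x \<le> y \<Longrightarrow> stop_loss y \<le> stop_loss x"
  using stop_loss_diff_ge[of x y] tail_bounds(1)[of y]
  by (meson diff_ge_0_iff_ge mult_nonneg_nonneg order_trans)

lemma stop_loss_diff_gap:
  assumes "x \<le> y" and gap: "AE t in \<mu>. t \<notin> {x<..<y}"
  shows "stop_loss x - stop_loss y = (y - x) * tail x"
proof -
  have "(\<integral>t. max 0 (t - x) - max 0 (t - y) \<partial>\<mu>) = (\<integral>t. (y - x) * indicator {x<..} t \<partial>\<mu>)"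
  proof (rule integral_cong_AE)
    show "AE t in \<mu>. max 0 (t - x) - max 0 (t - y) = (y - x) * indicator {x<..} t"
      using gap by eventually_elim (use assms(1) in \<open>auto simp: indicator_def max_def\<close>)
  qed auto
  then show ?thesis
    by (simp only: stop_loss_diff integral_indicator_tail)
qed

lemma stop_loss_le_of_bounded:
  assumes "tail b = 0"
  shows "stop_loss x \<le> (b - x) * tail x"
proof -
  have "AE t in \<mu>. t \<notin> {b<..}"
    using assms by (subst prob_eq_0[symmetric]) (auto simp: tail_def)
  then have "(\<integral>t. max 0 (t - x) \<partial>\<mu>) \<le> (\<integral>t. (b - x) * indicator {x<..} t \<partial>\<mu>)"
    by (intro integral_mono_AE integrable_indicator_tail integrable_excess)
      (auto elim!: eventually_mono simp: indicator_def max_def)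
  then show ?thesis
    by (simp only: stop_loss_def integral_indicator_tail)
qed

lemma stop_loss_ge_mean: "expectation (\<lambda>t. t) - x \<le> stop_loss x"
proof -
  have "expectation (\<lambda>t. t - x) \<le> stop_loss x"
    unfolding stop_loss_def by (intro integral_mono) (auto simp: integrable_id)
  then show ?thesis
    by (simp add: integrable_id prob_space[simplified])
qed

lemma stop_loss_tendsto_at_top: "(stop_loss \<longlongrightarrow> 0) at_top"
proof -
  have "((\<lambda>x. \<integral>t. max 0 (t - x) \<partial>\<mu>) \<longlongrightarrow> (\<integral>t. 0 \<partial>\<mu>)) at_top"
  proof (rule integral_dominated_convergence_at_top)
    show "AE t in \<mu>. ((\<lambda>x. max 0 (t - x)) \<longlongrightarrow> 0) at_top"
    proof (rule AE_I2, rule tendsto_eventually)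
      fix t :: real
      show "\<forall>\<^sub>F x in at_top. max 0 (t - x) = 0"
        using eventually_ge_at_top[of t] by eventually_elim auto
    qed
    show "\<forall>\<^sub>F x in at_top. AE t in \<mu>. norm (max 0 (t - x)) \<le> \<bar>t\<bar>"
      using eventually_ge_at_top[of 0] by eventually_elim auto
    show "integrable \<mu> (\<lambda>t. \<bar>t\<bar>)"
      using integrable_id by (rule integrable_abs)
  qed auto
  then show ?thesis
    by (simp add: stop_loss_def[abs_def])
qed

lemma point_of_positive_prob:
  assumes "AE x in \<mu>. P x" "0 < prob A" "A \<in> events"
  obtains x where "x \<in> A" "P x"
proof -
  have "\<not> (AE x in \<mu>. x \<notin> A)"
    using assms(2,3) prob_eq_0[of A] by auto
  moreover have "AE x in \<mu>. x \<notin> A" if "\<forall>x\<in>A. \<not> P x"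
    using assms(1) by eventually_elim (use that in blast)
  ultimately show thesis
    using that by blast
qed

text \<open>
  Every point outside the support lies in a null interval with rational endpoints, and there are
  only countably many of those.
\<close>

lemma AE_in_supp: "AE x in \<mu>. x \<in> supp (cdf \<mu>)"
proof -
  define J where "J = {(p, q). p \<in> \<rat> \<and> q \<in> \<rat> \<and> prob {p<..<q} = 0}"
  have "countable J"
    by (rule countable_subset[of _ "\<rat> \<times> \<rat>"]) (auto simp: J_def countable_rat)
  then have "AE x in \<mu>. \<forall>(p, q)\<in>J. x \<notin> {p<..<q}"
    unfolding case_prod_beta
    by (subst AE_ball_countable) (auto simp: J_def prob_eq_0 simp del: greaterThanLessThan_iff)
  then show ?thesis
  proof eventually_elim
    case (elim x)
    show ?case
      unfolding supp_def
    proof (rule CollectI, intro allI impI)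
      fix \<epsilon> :: real
      assume "0 < \<epsilon>"
      then obtain p q where p: "p \<in> \<rat>" "x - \<epsilon> < p" "p < x" and q: "q \<in> \<rat>" "x < q" "q < x + \<epsilon>"
        using Rats_dense_in_real[of "x - \<epsilon>" x] Rats_dense_in_real[of x "x + \<epsilon>"] by auto
      have "0 < prob {p<..<q}"
        using elim p q by (auto simp: J_def zero_less_measure_iff)
      moreover have "prob {p<..<q} \<le> prob {x - \<epsilon><..x + \<epsilon>}"
        using p q by (intro finite_measure_mono) auto
      ultimately show "0 < cdf \<mu> (x + \<epsilon>) - cdf \<mu> (x - \<epsilon>)"
        using \<open>0 < \<epsilon>\<close> by (subst cdf_diff_eq) auto
    qed
  qed
qed

section \<open>Laws for which almost every point is balanced\<close>

text \<open>
  If \<open>G(b) = 0\<close>, a balanced \<open>x \<le> b\<close> with \<open>G(x + \<delta>) > 0\<close> satisfies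
  \<open>G(x + \<delta>) = c h(x) \<le> c (b - x) G(x + \<delta>)\<close>, hence \<open>x \<le> b - 1 / c\<close>. Therefore \<open>G\<close> also vanishes at
  \<open>b - \<epsilon>\<close> for a fixed \<open>\<epsilon> > 0\<close>, and by iteration arbitrarily far to the left.
\<close>

lemma balanced_unbounded:
  assumes bal: "AE x in \<mu>. tail (x + \<delta>) = c * stop_loss x" and c: "c > 0" and \<delta>: "\<delta> < 0"
  shows "0 < tail b"
proof (rule ccontr)
  define \<epsilon> where "\<epsilon> = min \<bar>\<delta>\<bar> (1 / c)"
  have \<epsilon>: "0 < \<epsilon>" "\<epsilon> \<le> - \<delta>" "\<epsilon> \<le> 1 / c"
    using c \<delta> by (auto simp: \<epsilon>_def)
  have step: "tail (b - \<epsilon>) = 0" if b: "tail b = 0" for b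
  proof (rule ccontr)
    assume "tail (b - \<epsilon>) \<noteq> 0"
    then have pos: "0 < tail (b - \<epsilon>)"
      using tail_bounds(1)[of "b - \<epsilon>"] by simp
    then have "0 < prob {b - \<epsilon><..b}"
      using tail_diff[of "b - \<epsilon>" b] b \<epsilon>(1) by simp
    then obtain x where x: "b - \<epsilon> < x" "x \<le> b" and eq: "tail (x + \<delta>) = c * stop_loss x"
      using point_of_positive_prob[OF bal, of "{b - \<epsilon><..b}"] by auto
    have "0 < tail (x + \<delta>)"
      using pos tail_antimono[of "x + \<delta>" "b - \<epsilon>"] x \<epsilon> by simp
    have "tail (x + \<delta>) \<le> c * (b - x) * tail x"
      using stop_loss_le_of_bounded[OF b, of x] c unfolding eq by simp
    also have "\<dots> \<le> c * (b - x) * tail (x + \<delta>)"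
      using x c \<delta> by (intro mult_left_mono tail_antimono) auto
    finally have "1 \<le> c * (b - x)"
      using \<open>0 < tail (x + \<delta>)\<close> by simp
    moreover have "c * (b - x) < c * (1 / c)"
      using x \<epsilon> c by (intro mult_strict_left_mono) auto
    ultimately show False
      using c by simp
  qed
  assume "\<not> 0 < tail b"
  then have "tail b = 0"
    using tail_bounds(1)[of b] by simp
  then have iter: "tail (b - real n * \<epsilon>) = 0" for n
  proof (induction n)
    case (Suc n)
    then show ?case
      using step[of "b - real n * \<epsilon>"] by (simp add: algebra_simps)
  qed simp
  have "\<forall>\<^sub>F x in at_bot. 0 < tail x"
    using tail_tendsto_at_bot by (rule order_tendstoD) simp
  then obtain y where y: "\<And>x. x \<le> y \<Longrightarrow> 0 < tail x"
    by (auto simp: eventually_at_bot_linorder)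
  obtain n where "(b - y) / \<epsilon> < real n"
    using reals_Archimedean2 by blast
  then show False
    using y[of "b - real n * \<epsilon>"] iter[of n] \<epsilon>(1) by (simp add: field_simps)
qed

text \<open>
  By the bound \<open>h(x) \<ge> E X - x\<close> and \<open>G \<le> 1\<close>, balance at \<open>x\<close> gives \<open>c (E X - x) \<le> 1\<close>.
\<close>

lemma balanced_lower_bound:
  assumes "tail (x + \<delta>) = c * stop_loss x" "c > 0"
  shows "expectation (\<lambda>t. t) - 1 / c \<le> x"
proof -
  have "c * (expectation (\<lambda>t. t) - x) \<le> 1"
    using order_trans[OF mult_left_mono[OF stop_loss_ge_mean[of x], of c]] assms
      tail_bounds(2)[of "x + \<delta>"] by simp
  then show ?thesis
    using assms(2) by (simp add: field_simps)
qed

text \<open>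
  A pair of balanced points \<open>x < y\<close> closer than \<open>\<bar>\<delta>\<bar>\<close> yields a balanced \<open>z \<in> (x + \<delta>, y + \<delta>]\<close>, and then
  \<open>z < x\<close> is again such a pair. Two of these moves lower the upper point by at
  least \<open>\<bar>\<delta>\<bar>\<close>, so the descent would cross the lower bound for balanced points.
\<close>

lemma balanced_separated:
  assumes bal: "AE x in \<mu>. tail (x + \<delta>) = c * stop_loss x" and c: "c > 0" and \<delta>: "\<delta> < 0"
    and x: "tail (x + \<delta>) = c * stop_loss x" and y: "tail (y + \<delta>) = c * stop_loss y" and "x < y"
  shows "\<bar>\<delta>\<bar> \<le> y - x"
proof (rule ccontr)
  define D where "D = {x. tail (x + \<delta>) = c * stop_loss x}"
  define L where "L = expectation (\<lambda>t. t) - 1 / c"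
  have L: "L \<le> x" if "x \<in> D" for x
    using that balanced_lower_bound[of x \<delta> c] c by (simp add: D_def L_def)
  \<comment> \<open>The mass of the shifted interval is \<open>c (h(x) - h(y)) > 0\<close>, so it contains a balanced point.\<close>
  have new: "\<exists>z\<in>D. x + \<delta> < z \<and> z \<le> y + \<delta>" if "x \<in> D" "y \<in> D" "x < y" for x y
  proof -
    have "0 < (y - x) * tail y"
      using \<open>x < y\<close> balanced_unbounded[OF bal c \<delta>, of y] by simp
    also have "\<dots> \<le> stop_loss x - stop_loss y"
      using \<open>x < y\<close> by (intro stop_loss_diff_ge) simp
    finally have "0 < c * stop_loss x - c * stop_loss y"
      using c by (simp add: right_diff_distrib[symmetric])
    also have "\<dots> = tail (x + \<delta>) - tail (y + \<delta>)"
      using that by (simp add: D_def)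
    also have "\<dots> = prob {x + \<delta><..y + \<delta>}"
      using \<open>x < y\<close> by (intro tail_diff) simp
    finally obtain z where "z \<in> {x + \<delta><..y + \<delta>}" "tail (z + \<delta>) = c * stop_loss z"
      using point_of_positive_prob[OF bal, of "{x + \<delta><..y + \<delta>}"] by auto
    then show ?thesis
      by (auto simp: D_def)
  qed
  have far: "L + real n * \<bar>\<delta>\<bar> \<le> y" if "x \<in> D" "y \<in> D" "x < y" "y - x < \<bar>\<delta>\<bar>" for n x y
    using that
  proof (induction n arbitrary: x y)
    case 0
    then show ?case
      using L by simp
  next
    case (Suc n)
    obtain z where z: "z \<in> D" "x + \<delta> < z" "z \<le> y + \<delta>"
      using new[OF Suc.prems(1-3)] by auto
    then have "z < x" "x - z < \<bar>\<delta>\<bar>"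
      using Suc.prems(4) \<delta> by auto
    then obtain w where w: "w \<in> D" "z + \<delta> < w" "w \<le> x + \<delta>"
      using new[OF z(1) Suc.prems(1)] by auto
    then have "w < z" "z - w < \<bar>\<delta>\<bar>"
      using z \<delta> by auto
    from Suc.IH[OF w(1) z(1) this] show ?case
      using z(3) \<delta> by (simp add: algebra_simps)
  qed
  assume close: "\<not> \<bar>\<delta>\<bar> \<le> y - x"
  obtain n where "(y - L) / \<bar>\<delta>\<bar> < real n"
    using reals_Archimedean2 by blast
  moreover have "L + real n * \<bar>\<delta>\<bar> \<le> y"
    using far[of x y n] x y \<open>x < y\<close> close by (simp add: D_def)
  ultimately show False
    using \<delta> by (simp add: field_simps)
qed

end

text \<open>
  Numbering the cells of a grid of width \<open>d\<close> that starts at \<open>L\<close> embeds the set monotonically into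
  \<open>nat\<close>, where infinite sets come with an increasing enumeration.
\<close>

lemma separated_set_enumeration:
  fixes S :: "real set"
  assumes d: "0 < d" and lower: "\<And>x. x \<in> S \<Longrightarrow> L \<le> x"
    and sep: "\<And>x y. \<lbrakk>x \<in> S; y \<in> S; x < y\<rbrakk> \<Longrightarrow> d \<le> y - x"
    and "infinite S"
  obtains a :: "nat \<Rightarrow> real" where "strict_mono a" "range a = S"
proof -
  define f where "f x = nat \<lfloor>(x - L) / d\<rfloor>" for x
  have f_mono: "f x < f y" if "x \<in> S" "y \<in> S" "x < y" for x y
  proof -
    have "(x - L) / d + 1 \<le> (y - L) / d"
      using divide_right_mono[OF sep[OF that], of d] d by (simp add: diff_divide_distrib)
    then have "\<lfloor>(x - L) / d\<rfloor> < \<lfloor>(y - L) / d\<rfloor>"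
      by linarith
    moreover have "0 \<le> \<lfloor>(x - L) / d\<rfloor>"
      using lower[OF that(1)] d by simp
    ultimately show ?thesis
      by (simp only: f_def nat_less_eq_zless)
  qed
  have "inj_on f S"
    by (rule linorder_inj_onI) (use f_mono in force)+
  then have inf: "infinite (f ` S)"
    using \<open>infinite S\<close> finite_imageD by blast
  define a where "a n = inv_into S f (enumerate (f ` S) n)" for n
  have a: "a n \<in> S" "f (a n) = enumerate (f ` S) n" for n
    using enumerate_in_set[OF inf, of n] by (auto simp: a_def inv_into_into f_inv_into_f)
  have "strict_mono a"
  proof (rule strict_monoI)
    fix m n :: nat
    assume "m < n"
    then have "f (a m) < f (a n)"
      using inf by (simp add: a(2))
    then show "a m < a n"
      using f_mono[OF a(1)[of n] a(1)[of m]] by (cases "a m" "a n" rule: linorder_cases) auto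
  qed
  moreover have "x \<in> range a" if "x \<in> S" for x
  proof -
    have "f x \<in> range (enumerate (f ` S))"
      using that by (simp only: range_enumerate[OF inf] imageI)
    then obtain n where n: "f x = enumerate (f ` S) n"
      by (rule rangeE)
    have "a n = x"
      unfolding a_def n[symmetric] using \<open>inj_on f S\<close> that by (rule inv_into_f_f)
    then show ?thesis
      by (rule range_eqI[OF sym])
  qed
  ultimately have "strict_mono a" "range a = S"
    using a(1) by auto
  then show thesis
    by (rule that)
qed

lemma left_end_eq:
  fixes a :: "nat \<Rightarrow> real"
  assumes "supp F = range a" "mono a"
  shows "left_end F = ereal (a 0)"
  unfolding left_end_def assms(1)
  by (rule Inf_eqI) (auto intro: monoD[OF assms(2)])

context integrable_law
begin

text \<open>
  A support point is a limit of balanced points, and a separated set contains its limits; without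
  this one would only know that almost every support point is balanced.
\<close>

lemma balanced_supp:
  assumes bal: "AE x in \<mu>. tail (x + \<delta>) = c * stop_loss x" and c: "c > 0" and \<delta>: "\<delta> < 0"
    and x: "x \<in> supp (cdf \<mu>)"
  shows "tail (x + \<delta>) = c * stop_loss x"
proof (rule ccontr)
  define D where "D = {x. tail (x + \<delta>) = c * stop_loss x}"
  have near: "\<exists>p\<in>D. \<bar>p - x\<bar> \<le> \<epsilon>" if "0 < \<epsilon>" for \<epsilon>
  proof -
    have "0 < cdf \<mu> (x + \<epsilon>) - cdf \<mu> (x - \<epsilon>)"
      using x that by (simp add: supp_def)
    then have "0 < prob {x - \<epsilon><..x + \<epsilon>}"
      using that by (subst (asm) cdf_diff_eq) auto
    then obtain p where "p \<in> {x - \<epsilon><..x + \<epsilon>}" "p \<in> D"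
      using point_of_positive_prob[OF bal, of "{x - \<epsilon><..x + \<epsilon>}"] by (auto simp: D_def)
    then show ?thesis
      by (intro bexI[of _ p]) auto
  qed
  assume "tail (x + \<delta>) \<noteq> c * stop_loss x"
  then have "x \<notin> D"
    by (simp add: D_def)
  \<comment> \<open>Two distinct balanced points within \<open>\<bar>\<delta>\<bar> / 3\<close> of \<open>x\<close> contradict separation.\<close>
  obtain p where p: "p \<in> D" "\<bar>p - x\<bar> \<le> \<bar>\<delta>\<bar> / 3"
    using near[of "\<bar>\<delta>\<bar> / 3"] \<delta> by auto
  then have "0 < \<bar>p - x\<bar>"
    using \<open>x \<notin> D\<close> by auto
  then obtain q where q: "q \<in> D" "\<bar>q - x\<bar> \<le> \<bar>p - x\<bar> / 2"
    using near[of "\<bar>p - x\<bar> / 2"] by auto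
  have "p \<noteq> q"
    using q(2) \<open>0 < \<bar>p - x\<bar>\<close> by auto
  moreover have "\<bar>p - q\<bar> < \<bar>\<delta>\<bar>"
    using abs_triangle_ineq4[of "p - x" "q - x"] p(2) q(2) \<delta> by simp
  ultimately show False
    using balanced_separated[OF bal c \<delta>, of p q] balanced_separated[OF bal c \<delta>, of q p] p(1) q(1)
    by (auto simp: D_def abs_if split: if_splits)
qed

lemma balanced_cond_a:
  assumes bal: "AE x in \<mu>. tail (x + \<delta>) = c * stop_loss x" and c: "c > 0" and \<delta>: "\<delta> < 0"
  obtains a where "cond_a (cdf \<mu>) \<delta> a"
proof -
  let ?S = "supp (cdf \<mu>)"
  have S: "tail (x + \<delta>) = c * stop_loss x" if "x \<in> ?S" for x
    using balanced_supp[OF bal c \<delta> that] .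
  have above: "\<exists>x\<in>?S. b < x" for b
    using point_of_positive_prob[OF AE_in_supp, of "{b<..}"] balanced_unbounded[OF bal c \<delta>, of b]
    by (auto simp: tail_def)
  have inf: "infinite ?S"
  proof
    assume "finite ?S"
    then obtain b where "\<forall>x\<in>?S. x \<le> b"
      by (meson bdd_above_finite bdd_above_def)
    then show False
      using above[of b] by force
  qed
  have sep: "\<bar>\<delta>\<bar> \<le> y - x" if "x \<in> ?S" "y \<in> ?S" "x < y" for x y
    using that S balanced_separated[OF bal c \<delta>] by blast
  obtain a :: "nat \<Rightarrow> real" where a: "strict_mono a" "range a = ?S"
  proof (rule separated_set_enumeration)
    show "0 < \<bar>\<delta>\<bar>"
      using \<delta> by simp
    show "expectation (\<lambda>t. t) - 1 / c \<le> x" if "x \<in> ?S" for x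
      using S[OF that] c by (rule balanced_lower_bound)
    show "\<bar>\<delta>\<bar> \<le> y - x" if "x \<in> ?S" "y \<in> ?S" "x < y" for x y
      using that by (rule sep)
    show "infinite ?S"
      by (fact inf)
  qed
  have "cond_a (cdf \<mu>) \<delta> a"
    unfolding cond_a_def
  proof (intro conjI allI)
    show "ereal (a 0) = left_end (cdf \<mu>)"
      using left_end_eq[of "cdf \<mu>" a] a by (simp add: strict_mono_mono)
    show "\<bar>\<delta>\<bar> \<le> a (n + 1) - a n" for n
      using a(2) by (intro sep strict_monoD[OF a(1)]) auto
  qed (use a in auto)
  then show thesis
    using that by blast
qed

end

section \<open>Laws with a separated increasing support\<close>

lemma cond_a_at_top:
  assumes "cond_a F \<delta> a" "\<delta> \<noteq> 0"
  shows "filterlim a at_top sequentially"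
proof -
  have ge: "a 0 + real n * \<bar>\<delta>\<bar> \<le> a n" for n
  proof (induction n)
    case (Suc n)
    moreover have "\<bar>\<delta>\<bar> \<le> a (Suc n) - a n"
      using assms(1) by (simp add: cond_a_def)
    ultimately show ?case
      by (simp add: algebra_simps)
  qed simp
  have "filterlim (\<lambda>n. a 0 + real n * \<bar>\<delta>\<bar>) at_top sequentially"
    using assms(2)
    by (intro filterlim_tendsto_add_at_top[OF tendsto_const]
        filterlim_at_top_mult_tendsto_pos[OF tendsto_const _ filterlim_real_sequentially]) auto
  then show ?thesis
    by (rule filterlim_at_top_mono) (simp add: ge)
qed

lemma cond_a_right_end:
  assumes "cond_a F \<delta> a" "\<delta> \<noteq> 0"
  shows "right_end F = \<infinity>"
  unfolding right_end_def
proof (rule SUP_PInfty)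
  fix n :: nat
  have "\<forall>\<^sub>F k in sequentially. real n \<le> a k"
    using cond_a_at_top[OF assms] by (simp add: filterlim_at_top)
  then obtain k where "real n \<le> a k"
    by (auto simp: eventually_sequentially)
  then show "\<exists>x\<in>supp F. ereal (real n) \<le> ereal x"
    using assms(1) by (auto simp: cond_a_def)
qed

context integrable_law
begin

text \<open>
  The shift by \<open>\<delta>\<close> moves \<open>a (n + 1)\<close> to the left without passing \<open>a n\<close>; this is where the separation
  \<open>\<bar>\<delta>\<bar> \<le> a (n + 1) - a n\<close> enters.
\<close>

lemma cond_a_tail:
  assumes a: "cond_a (cdf \<mu>) \<delta> a" and "\<delta> < 0"
  shows cond_a_tail_0: "tail (a 0 + \<delta>) = 1"
    and cond_a_tail_Suc: "tail (a (Suc n) + \<delta>) = tail (a n)"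
    and cond_a_stop_loss: "stop_loss (a n) - stop_loss (a (Suc n)) = (a (Suc n) - a n) * tail (a n)"
proof -
  have atoms: "AE x in \<mu>. x \<in> range a"
    using AE_in_supp a by (simp add: cond_a_def)
  have mono: "strict_mono a" and step: "\<bar>\<delta>\<bar> \<le> a (Suc n) - a n" for n
    using a by (auto simp: cond_a_def)
  have gap: "AE x in \<mu>. x \<notin> {a n<..<a (Suc n)}" for n
    using atoms by eventually_elim (auto simp: strict_mono_less[OF mono])
  show "stop_loss (a n) - stop_loss (a (Suc n)) = (a (Suc n) - a n) * tail (a n)"
    using mono gap by (intro stop_loss_diff_gap) (auto simp: strict_mono_less_eq)
  have "AE x in \<mu>. x \<in> {a 0 + \<delta><..}"
    using atoms
  proof eventually_elim
    case (elim x)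
    then obtain k where "x = a k"
      by blast
    moreover have "a 0 \<le> a k"
      using mono by (simp add: strict_mono_less_eq)
    ultimately show ?case
      using \<open>\<delta> < 0\<close> by simp
  qed
  then show "tail (a 0 + \<delta>) = 1"
    by (subst (asm) prob_eq_1[symmetric]) (auto simp: tail_def)
  show "tail (a (Suc n) + \<delta>) = tail (a n)"
  proof (cases "a n = a (Suc n) + \<delta>")
    case False
    then have less: "a n < a (Suc n) + \<delta>"
      using step[of n] \<open>\<delta> < 0\<close> by simp
    have "AE x in \<mu>. x \<notin> {a n<..a (Suc n) + \<delta>}"
      using gap[of n] by eventually_elim (use \<open>\<delta> < 0\<close> in auto)
    then have "prob {a n<..a (Suc n) + \<delta>} = 0"
      by (subst (asm) prob_eq_0[symmetric]) auto
    then show ?thesis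
      using tail_diff[OF less] by simp
  qed simp
qed

text \<open>
  Write \<open>g n\<close> for \<open>G(a n + \<delta>)\<close>, so that \<open>G(a n) = g (n + 1)\<close> and \<open>g 0 = 1\<close>. Balance at all \<open>a n\<close> and the product
  formula both amount to the recursion \<open>g n - g (n + 1) = c (a (n + 1) - a n) g (n + 1)\<close>: balance gives it by
  taking differences, and is recovered from it by telescoping to infinity, where \<open>g\<close> and \<open>h\<close> vanish.
\<close>

lemma cond_b_iff_balanced:
  assumes a: "cond_a (cdf \<mu>) \<delta> a" and c: "c > 0" and \<delta>: "\<delta> < 0"
  shows "cond_b (cdf \<mu>) c a \<longleftrightarrow> (\<forall>n. tail (a n + \<delta>) = c * stop_loss (a n))"
proof -
  define g where "g n = tail (a n + \<delta>)" for n
  define d where "d n = a (Suc n) - a n" for n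
  note tail_0 = cond_a_tail_0[OF a \<delta>] and tail_Suc = cond_a_tail_Suc[OF a \<delta>]
  have g: "g 0 = 1" "tail (a n) = g (Suc n)" for n
    using tail_0 tail_Suc by (auto simp: g_def)
  have "0 < d n" for n
    using a by (auto simp: cond_a_def d_def strict_mono_less)
  then have pos: "0 < 1 + c * d n" for n
    using c by (simp add: add_pos_pos)
  have sl: "stop_loss (a n) - stop_loss (a (Suc n)) = d n * g (Suc n)" for n
    using cond_a_stop_loss[OF a \<delta>, of n] by (simp add: d_def g)
  have top: "filterlim a at_top sequentially"
    using cond_a_at_top[OF a] \<delta> by simp
  have lim_g: "g \<longlonglongrightarrow> 0"
    using filterlim_compose[OF tail_tendsto_at_top top] LIMSEQ_imp_Suc[of g 0] by (simp add: g)
  have lim_sl: "(\<lambda>n. stop_loss (a n)) \<longlonglongrightarrow> 0"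
    by (rule filterlim_compose[OF stop_loss_tendsto_at_top top])
  have "(\<forall>n. g n = c * stop_loss (a n)) \<longleftrightarrow> (\<forall>n. g n - g (Suc n) = c * d n * g (Suc n))"
  proof
    assume "\<forall>n. g n = c * stop_loss (a n)"
    then show "\<forall>n. g n - g (Suc n) = c * d n * g (Suc n)"
      using sl by (simp add: right_diff_distrib[symmetric])
  next
    assume rec: "\<forall>n. g n - g (Suc n) = c * d n * g (Suc n)"
    \<comment> \<open>The defect of balance at \<open>a n\<close>: constant by the recursion, and a null sequence.\<close>
    define e where "e n = g n - c * stop_loss (a n)" for n
    have e_Suc: "e n = e (Suc n)" for n
    proof -
      have "c * stop_loss (a n) - c * stop_loss (a (Suc n)) = g n - g (Suc n)"
        using sl[of n] rec by (simp add: right_diff_distrib[symmetric])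
      then show ?thesis
        by (simp add: e_def)
    qed
    have e_const: "e n = e 0" for n
      by (induction n) (simp_all add: e_Suc[symmetric])
    have "(\<lambda>n. e n) \<longlonglongrightarrow> 0"
      using tendsto_diff[OF lim_g tendsto_mult_left[OF lim_sl, of c]] by (simp add: e_def)
    moreover have "(\<lambda>n. e n) = (\<lambda>n. e 0)"
      using e_const by (rule ext)
    ultimately have "(\<lambda>n. e 0) \<longlonglongrightarrow> 0"
      by (rule back_subst)
    then have "e 0 = 0"
      by (simp add: LIMSEQ_const_iff)
    then have "e n = 0" for n
      using e_const[of n] by (rule trans[rotated])
    then show "\<forall>n. g n = c * stop_loss (a n)"
      by (simp add: e_def)
  qed
  also have "\<dots> \<longleftrightarrow> (\<forall>n. g (Suc n) = g n * (1 / (1 + c * d n)))"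
  proof (rule all_cong1)
    fix n
    have "g n - g (Suc n) = c * d n * g (Suc n) \<longleftrightarrow> g (Suc n) * (1 + c * d n) = g n"
      by (auto simp: algebra_simps)
    also have "\<dots> \<longleftrightarrow> g (Suc n) = g n * (1 / (1 + c * d n))"
      using pos[of n] by (simp add: eq_divide_eq)
    finally show "g n - g (Suc n) = c * d n * g (Suc n) \<longleftrightarrow> g (Suc n) = g n * (1 / (1 + c * d n))" .
  qed
  also have "\<dots> \<longleftrightarrow> (\<forall>n. g (Suc n) = (\<Prod>i=0..n. 1 / (1 + c * d i)))"
  proof
    assume rec: "\<forall>n. g (Suc n) = g n * (1 / (1 + c * d n))"
    show "\<forall>n. g (Suc n) = (\<Prod>i=0..n. 1 / (1 + c * d i))"
    proof
      fix n
      show "g (Suc n) = (\<Prod>i=0..n. 1 / (1 + c * d i))"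
      proof (induction n)
        case 0
        then show ?case
          using rec[rule_format, of 0] by (simp add: g)
      next
        case (Suc n)
        have "g (Suc (Suc n)) = g (Suc n) * (1 / (1 + c * d (Suc n)))"
          using rec by blast
        then show ?case
          by (simp only: Suc.IH prod.atLeast0_atMost_Suc)
      qed
    qed
  next
    assume prod: "\<forall>n. g (Suc n) = (\<Prod>i=0..n. 1 / (1 + c * d i))"
    show "\<forall>n. g (Suc n) = g n * (1 / (1 + c * d n))"
    proof
      fix n
      show "g (Suc n) = g n * (1 / (1 + c * d n))"
      proof (cases n)
        case 0
        then show ?thesis
          using prod[rule_format, of 0] by (simp add: g(1))
      next
        case (Suc m)
        then show ?thesis
          by (simp only: prod[rule_format] prod.atLeast0_atMost_Suc)
      qed
    qed
  qed
  also have "\<dots> \<longleftrightarrow> cond_b (cdf \<mu>) c a"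
    by (simp add: cond_b_def tail_eq_cdf[symmetric] g d_def)
  finally show ?thesis
    by (simp add: g_def)
qed

lemma balanced_iff_conditions:
  assumes c: "c > 0" and \<delta>: "\<delta> < 0"
  shows "(AE x in \<mu>. tail (x + \<delta>) = c * stop_loss x) \<longleftrightarrow>
    (\<exists>a. cond_a (cdf \<mu>) \<delta> a \<and> cond_b (cdf \<mu>) c a)"
proof
  assume bal: "AE x in \<mu>. tail (x + \<delta>) = c * stop_loss x"
  obtain a where a: "cond_a (cdf \<mu>) \<delta> a"
    using balanced_cond_a[OF bal c \<delta>] .
  then have "a n \<in> supp (cdf \<mu>)" for n
    by (simp add: cond_a_def)
  then have "cond_b (cdf \<mu>) c a"
    using cond_b_iff_balanced[OF a c \<delta>] balanced_supp[OF bal c \<delta>] by blast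
  then show "\<exists>a. cond_a (cdf \<mu>) \<delta> a \<and> cond_b (cdf \<mu>) c a"
    using a by blast
next
  assume "\<exists>a. cond_a (cdf \<mu>) \<delta> a \<and> cond_b (cdf \<mu>) c a"
  then obtain a where a: "cond_a (cdf \<mu>) \<delta> a" and b: "cond_b (cdf \<mu>) c a"
    by blast
  have "AE x in \<mu>. x \<in> range a"
    using AE_in_supp a by (simp add: cond_a_def)
  then show "AE x in \<mu>. tail (x + \<delta>) = c * stop_loss x"
    by eventually_elim (use b cond_b_iff_balanced[OF a c \<delta>] in auto)
qed

end

section \<open>The drift of the compensated record count\<close>

text \<open>
  The freezing lemma. To test the claim on \<open>A \<in> H\<close>, put the indicator of \<open>A\<close> and \<open>U\<close> into one \<open>H\<close>-measurable
  vector \<open>V\<close>: it is independent of \<open>X\<close>, so the law of \<open>(V, X)\<close> is a product and Fubini's theorem applies.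
\<close>

lemma (in prob_space) cond_exp_independent:
  fixes U X :: "'a \<Rightarrow> real" and \<phi> :: "real \<Rightarrow> real \<Rightarrow> real"
  assumes sub: "subalgebra M H" and U: "U \<in> borel_measurable H"
    and X [measurable]: "random_variable borel X"
    and ind: "indep_set (sets H) (sigma_sets (space M) {X -` B \<inter> space M | B. B \<in> sets borel})"
    and \<phi> [measurable]: "(\<lambda>(u, x). \<phi> u x) \<in> borel_measurable (borel \<Otimes>\<^sub>M borel)"
    and int: "integrable M (\<lambda>\<omega>. \<phi> (U \<omega>) (X \<omega>))"
  shows "AE \<omega> in M. real_cond_exp M H (\<lambda>\<omega>. \<phi> (U \<omega>) (X \<omega>)) \<omega> = (\<integral>x. \<phi> (U \<omega>) x \<partial>distr M borel X)"
proof -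
  interpret H: finite_measure_subalgebra M H
    by unfold_locales (rule sub)
  define \<nu> where "\<nu> = distr M borel X"
  interpret \<nu>: prob_space \<nu>
    unfolding \<nu>_def by (rule prob_space_distr) simp
  have [measurable_cong]: "sets \<nu> = sets borel"
    by (simp add: \<nu>_def)
  define \<psi> where "\<psi> u = (\<integral>x. \<phi> u x \<partial>\<nu>)" for u
  have \<psi> [measurable]: "\<psi> \<in> borel_measurable borel"
    unfolding \<psi>_def by measurable
  have U_M [measurable]: "U \<in> borel_measurable M"
    using sub U by (rule measurable_from_subalg)
  have spaces: "space H = space M"
    using sub by (simp add: subalgebra_def)
  have key: "integrable M (\<lambda>\<omega>. indicator A \<omega> * \<psi> (U \<omega>)) \<and>
    (\<integral>\<omega>. indicator A \<omega> * \<phi> (U \<omega>) (X \<omega>) \<partial>M) = (\<integral>\<omega>. indicator A \<omega> * \<psi> (U \<omega>) \<partial>M)"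
    if A: "A \<in> sets H" for A
  proof -
    have A_M [measurable]: "A \<in> events"
      using A sub by (auto simp: subalgebra_def)
    define V where "V \<omega> = (indicator A \<omega> :: real, U \<omega>)" for \<omega>
    define f where "f v x = fst v * \<phi> (snd v) x" for v :: "real \<times> real" and x
    have f [measurable]: "(\<lambda>(v, x). f v x) \<in> borel_measurable ((borel \<Otimes>\<^sub>M borel) \<Otimes>\<^sub>M borel)"
      unfolding f_def by measurable
    have V_H: "V \<in> measurable H (borel \<Otimes>\<^sub>M borel)"
      unfolding V_def using A U by measurable
    have V [measurable]: "V \<in> measurable M (borel \<Otimes>\<^sub>M borel)"
      using sub V_H by (rule measurable_from_subalg)
    interpret V: prob_space "distr M (borel \<Otimes>\<^sub>M borel) V"
      by (rule prob_space_distr) simp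
    have joint: "distr M (borel \<Otimes>\<^sub>M borel) V \<Otimes>\<^sub>M \<nu> =
        distr M ((borel \<Otimes>\<^sub>M borel) \<Otimes>\<^sub>M borel) (\<lambda>\<omega>. (V \<omega>, X \<omega>))"
    proof (rule pair_measure_eqI)
      fix B C
      assume "B \<in> sets (distr M (borel \<Otimes>\<^sub>M borel) V)" "C \<in> sets \<nu>"
      then have B [measurable]: "B \<in> sets (borel \<Otimes>\<^sub>M borel)" and C [measurable]: "C \<in> sets borel"
        by (simp_all add: \<nu>_def)
      have "V -` B \<inter> space M \<in> sets H"
        using measurable_sets[OF V_H B] by (simp add: spaces)
      moreover have "X -` C \<inter> space M \<in> sigma_sets (space M) {X -` B \<inter> space M | B. B \<in> sets borel}"
        using C by (intro sigma_sets.Basic) blast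
      ultimately have "prob ((V -` B \<inter> space M) \<inter> (X -` C \<inter> space M)) =
          prob (V -` B \<inter> space M) * prob (X -` C \<inter> space M)"
        using ind unfolding indep_sets2_eq by blast
      moreover have "(\<lambda>\<omega>. (V \<omega>, X \<omega>)) -` (B \<times> C) \<inter> space M = (V -` B \<inter> space M) \<inter> (X -` C \<inter> space M)"
        by auto
      ultimately show "emeasure (distr M (borel \<Otimes>\<^sub>M borel) V) B * emeasure \<nu> C =
          emeasure (distr M ((borel \<Otimes>\<^sub>M borel) \<Otimes>\<^sub>M borel) (\<lambda>\<omega>. (V \<omega>, X \<omega>))) (B \<times> C)"
        by (simp add: \<nu>_def emeasure_distr emeasure_eq_measure ennreal_mult[symmetric])
    qed (auto simp: \<nu>_def intro!: \<nu>.sigma_finite_measure_axioms[unfolded \<nu>_def] V.sigma_finite_measure_axioms)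
    interpret P: pair_prob_space "distr M (borel \<Otimes>\<^sub>M borel) V" \<nu> ..
    have "integrable M (\<lambda>\<omega>. indicator A \<omega> * \<phi> (U \<omega>) (X \<omega>))"
      using integrable_mult_indicator[OF A_M int] by simp
    then have int_f: "integrable (distr M (borel \<Otimes>\<^sub>M borel) V \<Otimes>\<^sub>M \<nu>) (\<lambda>(v, x). f v x)"
      unfolding joint by (subst integrable_distr_eq) (auto simp: f_def V_def)
    have inner: "(\<integral>x. f v x \<partial>\<nu>) = fst v * \<psi> (snd v)" for v
      by (simp add: f_def \<psi>_def)
    have "integrable (distr M (borel \<Otimes>\<^sub>M borel) V) (\<lambda>v. fst v * \<psi> (snd v))"
      using P.integrable_fst[OF int_f] by (simp add: inner)
    then have "integrable M (\<lambda>\<omega>. indicator A \<omega> * \<psi> (U \<omega>))"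
      by (subst (asm) integrable_distr_eq) (auto simp: V_def)
    moreover have "(\<integral>\<omega>. indicator A \<omega> * \<phi> (U \<omega>) (X \<omega>) \<partial>M) = (\<integral>\<omega>. indicator A \<omega> * \<psi> (U \<omega>) \<partial>M)"
    proof -
      have "(\<integral>\<omega>. indicator A \<omega> * \<phi> (U \<omega>) (X \<omega>) \<partial>M) =
          (\<integral>z. (case z of (v, x) \<Rightarrow> f v x) \<partial>(distr M (borel \<Otimes>\<^sub>M borel) V \<Otimes>\<^sub>M \<nu>))"
        unfolding joint by (subst integral_distr) (auto simp: f_def V_def)
      also have "\<dots> = (\<integral>v. fst v * \<psi> (snd v) \<partial>distr M (borel \<Otimes>\<^sub>M borel) V)"
        using P.integral_fst[OF int_f] by (simp add: inner)
      also have "\<dots> = (\<integral>\<omega>. indicator A \<omega> * \<psi> (U \<omega>) \<partial>M)"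
        by (subst integral_distr) (auto simp: V_def)
      finally show ?thesis .
    qed
    ultimately show ?thesis ..
  qed
  have "AE \<omega> in M. real_cond_exp M H (\<lambda>\<omega>. \<phi> (U \<omega>) (X \<omega>)) \<omega> = \<psi> (U \<omega>)"
  proof (rule H.real_cond_exp_charact)
    show "(\<integral>\<omega>\<in>A. \<phi> (U \<omega>) (X \<omega>) \<partial>M) = (\<integral>\<omega>\<in>A. \<psi> (U \<omega>) \<partial>M)" if "A \<in> sets H" for A
      using key[OF that] by (simp add: set_lebesgue_integral_def)
    have "integrable M (\<lambda>\<omega>. indicator (space M) \<omega> * \<psi> (U \<omega>))"
      using key[of "space M"] sets.top[of H] by (simp add: spaces)
    then show "integrable M (\<lambda>\<omega>. \<psi> (U \<omega>))"
      by (rule Bochner_Integration.integrable_cong[THEN iffD1, rotated 2]) auto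
    show "(\<lambda>\<omega>. \<psi> (U \<omega>)) \<in> borel_measurable H"
      using U by measurable
  qed (rule int)
  then show ?thesis
    by (simp add: \<psi>_def \<nu>_def)
qed

locale iid_sample = prob_space M for M :: "'a measure" +
  fixes X :: "nat \<Rightarrow> 'a \<Rightarrow> real"
  assumes indep: "indep_vars (\<lambda>_. borel) X {1..}"
    and same_law: "1 \<le> n \<Longrightarrow> distr M borel (X n) = distr M borel (X 1)"
    and integrable_X: "1 \<le> n \<Longrightarrow> integrable M (X n)"
begin

lemma rv_X: "1 \<le> n \<Longrightarrow> random_variable borel (X n)"
  using integrable_X by (rule borel_measurable_integrable)

sublocale law: integrable_law "distr M borel (X 1)"
proof -
  interpret R: real_distribution "distr M borel (X 1)"
    by (rule real_distribution_distr) (simp add: rv_X)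
  show "integrable_law (distr M borel (X 1))"
    by unfold_locales (use integrable_X[of 1] in \<open>simp add: integrable_distr_eq rv_X\<close>)
qed

lemma sets_nat_filtration:
  "sets (nat_filtration M X n) =
    sigma_sets (space M) (\<Union>k\<in>{1..n}. {X k -` B \<inter> space M | B. B \<in> sets borel})"
  unfolding nat_filtration_def by (rule sets_measure_of) auto

lemma space_nat_filtration: "space (nat_filtration M X n) = space M"
  unfolding nat_filtration_def by (rule space_measure_of) auto

lemma subalgebra_nat_filtration: "subalgebra M (nat_filtration M X n)"
  unfolding subalgebra_def sets_nat_filtration space_nat_filtration
  by (intro conjI refl sets.sigma_sets_subset) (auto intro: measurable_sets[OF rv_X])

lemma filtration_nat_filtration: "filtration (space M) (nat_filtration M X)"
proof
  show "sets (nat_filtration M X i) \<subseteq> sets (nat_filtration M X j)" if "i \<le> j" for i j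
    unfolding sets_nat_filtration
  proof (rule sigma_sets_mono')
    show "(\<Union>k\<in>{1..i}. {X k -` B \<inter> space M | B. B \<in> sets borel})
      \<subseteq> (\<Union>k\<in>{1..j}. {X k -` B \<inter> space M | B. B \<in> sets borel})"
      using that by (intro UN_mono) auto
  qed
qed (rule space_nat_filtration)

lemma measurable_X_nat_filtration:
  assumes "1 \<le> k" "k \<le> n"
  shows "X k \<in> borel_measurable (nat_filtration M X n)"
proof (rule measurableI)
  fix B :: "real set"
  assume "B \<in> sets borel"
  then show "X k -` B \<inter> space (nat_filtration M X n) \<in> sets (nat_filtration M X n)"
    unfolding sets_nat_filtration space_nat_filtration
    using assms by (intro sigma_sets.Basic UN_I[of k]) auto
qed simp

lemma indep_past_next:
  "indep_set (sets (nat_filtration M X n))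
    (sigma_sets (space M) {X (Suc n) -` B \<inter> space M | B. B \<in> sets borel})"
proof -
  let ?E = "\<lambda>k. {X k -` B \<inter> space M | B. B \<in> sets borel}"
  let ?I = "\<lambda>b. if b then {1..n} else {Suc n}"
  have "indep_sets ?E {1..}"
    using indep unfolding indep_vars_def2 by simp
  then have "indep_sets ?E (\<Union>b\<in>UNIV. ?I b)"
    by (rule indep_sets_mono_index[rotated]) auto
  moreover have "Int_stable (?E k)" for k
  proof (rule Int_stableI)
    fix a b
    assume "a \<in> ?E k" "b \<in> ?E k"
    then obtain A B where "A \<in> sets borel" "B \<in> sets borel" "a = X k -` A \<inter> space M" "b = X k -` B \<inter> space M"
      by blast
    then show "a \<inter> b \<in> ?E k"
      by (intro CollectI exI[of _ "A \<inter> B"]) auto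
  qed
  moreover have "disjoint_family_on ?I UNIV"
    by (auto simp: disjoint_family_on_def)
  ultimately have "indep_sets (\<lambda>b. sigma_sets (space M) (\<Union>k\<in>?I b. ?E k)) UNIV"
    by (rule indep_sets_collect_sigma)
  then show ?thesis
    unfolding indep_set_def sets_nat_filtration
    by (rule indep_sets_cong[THEN iffD1, OF refl, rotated]) (auto split: bool.split)
qed

lemma run_max_1: "run_max X 1 = X 1"
  by (auto simp: run_max_def)

lemma run_max_Suc:
  assumes "1 \<le> n"
  shows "run_max X (Suc n) \<omega> = max (run_max X n \<omega>) (X (Suc n) \<omega>)"
proof -
  have "{1..Suc n} = insert (Suc n) {1..n}"
    by auto
  then show ?thesis
    using assms by (simp add: run_max_def max.commute)
qed

lemma run_max_attained:
  assumes "1 \<le> n"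
  obtains k where "1 \<le> k" "run_max X n \<omega> = X k \<omega>"
proof -
  have "run_max X n \<omega> \<in> (\<lambda>k. X k \<omega>) ` {1..n}"
    unfolding run_max_def using assms by (intro Max_in) auto
  then show thesis
    using that by auto
qed

lemma run_max_measurable: "run_max X n \<in> borel_measurable (nat_filtration M X n)"
  unfolding run_max_def[abs_def]
  by (rule borel_measurable_Max) (auto intro: measurable_X_nat_filtration)

lemma run_max_integrable: "1 \<le> n \<Longrightarrow> integrable M (run_max X n)"
proof (induction n rule: dec_induct)
  case base
  then show ?case
    unfolding run_max_1 by (rule integrable_X) simp
next
  case (step n)
  have "run_max X (Suc n) = (\<lambda>\<omega>. max (run_max X n \<omega>) (X (Suc n) \<omega>))"
    using run_max_Suc[OF step.hyps(1)] by (rule ext)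
  then show ?case
    using step.IH integrable_X[of "Suc n"] by simp
qed

lemma num_delta_records_measurable:
  "(\<lambda>\<omega>. real (num_delta_records X \<delta> n \<omega>)) \<in> borel_measurable (nat_filtration M X n)"
proof -
  have "(\<lambda>\<omega>. real (delta_record X \<delta> k \<omega>)) \<in> borel_measurable (nat_filtration M X n)"
    if k: "k \<in> {1..n}" for k
  proof (cases "k = 1")
    case False
    have [measurable]: "X k \<in> borel_measurable (nat_filtration M X n)"
      using k by (intro measurable_X_nat_filtration) auto
    have [measurable]: "run_max X (k - 1) \<in> borel_measurable (nat_filtration M X n)"
      unfolding run_max_def[abs_def]
      by (rule borel_measurable_Max) (use k in \<open>auto intro: measurable_X_nat_filtration\<close>)
    have "(\<lambda>\<omega>. real (delta_record X \<delta> k \<omega>)) =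
        (\<lambda>\<omega>. if run_max X (k - 1) \<omega> + \<delta> < X k \<omega> then 1 else 0)"
      using False by (auto simp: delta_record_def)
    then show ?thesis
      by (simp only:) measurable
  qed (simp add: delta_record_def)
  then show ?thesis
    by (simp add: num_delta_records_def)
qed

lemma num_delta_records_integrable: "integrable M (\<lambda>\<omega>. real (num_delta_records X \<delta> n \<omega>))"
proof (rule integrable_const_bound)
  have "num_delta_records X \<delta> n \<omega> \<le> (\<Sum>k=1..n. 1)" for \<omega>
    unfolding num_delta_records_def by (rule sum_mono) (simp add: delta_record_def)
  then show "AE \<omega> in M. norm (real (num_delta_records X \<delta> n \<omega>)) \<le> real n"
    by simp
  show "(\<lambda>\<omega>. real (num_delta_records X \<delta> n \<omega>)) \<in> borel_measurable M"
    by (rule measurable_from_subalg[OF subalgebra_nat_filtration num_delta_records_measurable])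
qed

abbreviation compensated :: "real \<Rightarrow> real \<Rightarrow> nat \<Rightarrow> 'a \<Rightarrow> real" where
  "compensated c \<delta> n \<omega> \<equiv> real (num_delta_records X \<delta> n \<omega>) - c * run_max X n \<omega>"

lemma compensated_increment:
  assumes "1 \<le> n"
  shows "compensated c \<delta> (Suc n) \<omega> = compensated c \<delta> n \<omega> +
    (indicator {run_max X n \<omega> + \<delta><..} (X (Suc n) \<omega>) - c * max 0 (X (Suc n) \<omega> - run_max X n \<omega>))"
  using assms
  by (auto simp: num_delta_records_def delta_record_def run_max_Suc max_def indicator_def algebra_simps)

lemma compensated_drift:
  assumes n: "1 \<le> n"
  shows "AE \<omega> in M. real_cond_exp M (nat_filtration M X n) (compensated c \<delta> (Suc n)) \<omega> =
    compensated c \<delta> n \<omega> + (law.tail (run_max X n \<omega> + \<delta>) - c * law.stop_loss (run_max X n \<omega>))"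
proof -
  let ?F = "nat_filtration M X n"
  define \<phi> where "\<phi> m x = indicator {m + \<delta><..} x - c * max 0 (x - m)" for m x :: real
  interpret F: finite_measure_subalgebra M ?F
    by unfold_locales (rule subalgebra_nat_filtration)
  have int_Z: "integrable M (compensated c \<delta> k)" if "1 \<le> k" for k
    using that run_max_integrable num_delta_records_integrable by simp
  have Z_eq: "compensated c \<delta> (Suc n) = (\<lambda>\<omega>. compensated c \<delta> n \<omega> + \<phi> (run_max X n \<omega>) (X (Suc n) \<omega>))"
    unfolding \<phi>_def using compensated_increment[OF n] by (rule ext)
  then have "(\<lambda>\<omega>. \<phi> (run_max X n \<omega>) (X (Suc n) \<omega>)) = (\<lambda>\<omega>. compensated c \<delta> (Suc n) \<omega> - compensated c \<delta> n \<omega>)"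
    by (simp add: fun_eq_iff)
  then have int_\<phi>: "integrable M (\<lambda>\<omega>. \<phi> (run_max X n \<omega>) (X (Suc n) \<omega>))"
    using int_Z[of n] int_Z[of "Suc n"] n by simp
  have mean: "(\<integral>x. \<phi> m x \<partial>distr M borel (X (Suc n))) = law.tail (m + \<delta>) - c * law.stop_loss m" for m
  proof -
    have "(\<integral>x. \<phi> m x \<partial>distr M borel (X 1)) = law.tail (m + \<delta>) - c * law.stop_loss m"
      unfolding \<phi>_def law.tail_def law.stop_loss_def
      using law.integrable_indicator_tail[of 1 "m + \<delta>"] law.integrable_excess[of m]
      by (subst Bochner_Integration.integral_diff) auto
    then show ?thesis
      using same_law[of "Suc n"] by simp
  qed
  have "(\<lambda>(m, x). \<phi> m x) \<in> borel_measurable (borel \<Otimes>\<^sub>M borel)"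
    unfolding \<phi>_def indicator_def greaterThan_iff by measurable
  from cond_exp_independent[OF subalgebra_nat_filtration run_max_measurable rv_X indep_past_next this int_\<phi>]
  have "AE \<omega> in M. real_cond_exp M ?F (\<lambda>\<omega>. \<phi> (run_max X n \<omega>) (X (Suc n) \<omega>)) \<omega> =
      law.tail (run_max X n \<omega> + \<delta>) - c * law.stop_loss (run_max X n \<omega>)"
    by (simp add: mean)
  moreover have "AE \<omega> in M. real_cond_exp M ?F (compensated c \<delta> n) \<omega> = compensated c \<delta> n \<omega>"
    using int_Z[OF n] num_delta_records_measurable run_max_measurable
    by (intro F.real_cond_exp_F_meas) auto
  moreover have "AE \<omega> in M. real_cond_exp M ?F (compensated c \<delta> (Suc n)) \<omega> =
      real_cond_exp M ?F (compensated c \<delta> n) \<omega> +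
      real_cond_exp M ?F (\<lambda>\<omega>. \<phi> (run_max X n \<omega>) (X (Suc n) \<omega>)) \<omega>"
    unfolding Z_eq using int_Z[OF n] int_\<phi> by (rule F.real_cond_exp_add)
  ultimately show ?thesis
    by eventually_elim simp
qed

lemma AE_X_iff:
  assumes "1 \<le> n" and [measurable]: "Measurable.pred borel P"
  shows "(AE \<omega> in M. P (X n \<omega>)) \<longleftrightarrow> (AE x in distr M borel (X 1). P x)"
  unfolding same_law[OF assms(1), symmetric]
  by (rule AE_distr_iff[symmetric]) (use rv_X[OF assms(1)] in auto)

text \<open>
  Time \<open>n = 1\<close> alone forces balance, as the maximum of one observation is the observation. Conversely,
  almost surely all observations are balanced points, and every maximum is one of them.
\<close>

lemma martingale_iff_balanced:
  "martingale_from_1 M (nat_filtration M X) (compensated c \<delta>) \<longleftrightarrow>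
    (AE x in distr M borel (X 1). law.tail (x + \<delta>) = c * law.stop_loss x)"
proof -
  let ?P = "\<lambda>x. law.tail (x + \<delta>) = c * law.stop_loss x"
  have [measurable]: "law.tail \<in> borel_measurable borel" "law.stop_loss \<in> borel_measurable borel"
    using borel_measurable_mono[of "\<lambda>x. - law.tail x"] borel_measurable_mono[of "\<lambda>x. - law.stop_loss x"]
      law.tail_antimono law.stop_loss_antimono by (auto simp: mono_def)
  have P: "Measurable.pred borel ?P"
    by measurable
  have "martingale_from_1 M (nat_filtration M X) (compensated c \<delta>) \<longleftrightarrow>
      (\<forall>n\<ge>1. AE \<omega> in M. real_cond_exp M (nat_filtration M X n) (compensated c \<delta> (n + 1)) \<omega> =
        compensated c \<delta> n \<omega>)"
    unfolding martingale_from_1_def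
    using filtration_nat_filtration subalgebra_nat_filtration num_delta_records_measurable
      run_max_measurable num_delta_records_integrable run_max_integrable
    by auto
  also have "\<dots> \<longleftrightarrow> (\<forall>n\<ge>1. AE \<omega> in M. ?P (run_max X n \<omega>))"
  proof (intro all_cong1 imp_cong refl)
    fix n :: nat
    assume "1 \<le> n"
    note drift = compensated_drift[OF this, where c = c and \<delta> = \<delta>]
    show "(AE \<omega> in M. real_cond_exp M (nat_filtration M X n) (compensated c \<delta> (n + 1)) \<omega> =
        compensated c \<delta> n \<omega>) \<longleftrightarrow> (AE \<omega> in M. ?P (run_max X n \<omega>))"
      unfolding Suc_eq_plus1[symmetric] using drift
      by (intro eventually_subst) (auto elim!: eventually_mono)
  qed
  also have "\<dots> \<longleftrightarrow> (AE x in distr M borel (X 1). ?P x)"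
  proof
    assume "\<forall>n\<ge>1. AE \<omega> in M. ?P (run_max X n \<omega>)"
    then have "AE \<omega> in M. ?P (run_max X 1 \<omega>)"
      by blast
    then show "AE x in distr M borel (X 1). ?P x"
      unfolding run_max_1 AE_X_iff[OF order_refl P] .
  next
    assume law: "AE x in distr M borel (X 1). ?P x"
    have all_X: "AE \<omega> in M. \<forall>k\<in>{1..}. ?P (X k \<omega>)"
      using law AE_X_iff[OF _ P] by (subst AE_ball_countable) auto
    show "\<forall>n\<ge>1. AE \<omega> in M. ?P (run_max X n \<omega>)"
    proof (intro allI impI)
      fix n :: nat
      assume "1 \<le> n"
      show "AE \<omega> in M. ?P (run_max X n \<omega>)"
        using all_X
      proof eventually_elim
        case (elim \<omega>)
        obtain k where "1 \<le> k" "run_max X n \<omega> = X k \<omega>"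
          using run_max_attained[OF \<open>1 \<le> n\<close>] .
        then show ?case
          using elim by simp
      qed
    qed
  qed
  finally show ?thesis .
qed

end

theorem theorem2:
  fixes M :: "'a measure" and X :: "nat \<Rightarrow> 'a \<Rightarrow> real"
    and F :: "real \<Rightarrow> real" and c \<delta> :: real
  assumes "iid_integrable M X F"
    and "\<not> degenerate F"
    and "c > 0" and "\<delta> < 0"
  shows "(F \<in> P_class M X c \<delta> \<longleftrightarrow> (\<exists>a. cond_a F \<delta> a \<and> cond_b F c a)) \<and>
         (\<forall>a. cond_a F \<delta> a \<longrightarrow> right_end F = \<infinity>)"
proof (intro conjI allI impI)
  have ps: "prob_space M" and F: "cdf (distr M borel (X n)) = F" and int: "integrable M (X n)"
    if "1 \<le> n" for n
    using assms(1) that by (auto simp: iid_integrable_def)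
  interpret prob_space M
    using ps[OF order_refl] .
  interpret iid_sample M X
  proof
    show "indep_vars (\<lambda>_. borel) X {1..}"
      using assms(1) by (simp add: iid_integrable_def)
    show "distr M borel (X n) = distr M borel (X 1)" if "1 \<le> n" for n
    proof (rule cdf_unique)
      show "cdf (distr M borel (X n)) = cdf (distr M borel (X 1))"
        using F that by simp
    qed (use int that in \<open>auto intro!: real_distribution_distr borel_measurable_integrable\<close>)
  qed (rule int)
  have "F \<in> P_class M X c \<delta> \<longleftrightarrow> martingale_from_1 M (nat_filtration M X) (compensated c \<delta>)"
    using assms(1,2) by (simp add: P_class_def)
  also have "\<dots> \<longleftrightarrow> (\<exists>a. cond_a F \<delta> a \<and> cond_b F c a)"
    unfolding martingale_iff_balanced law.balanced_iff_conditions[OF assms(3,4)] F[OF order_refl] ..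
  finally show "F \<in> P_class M X c \<delta> \<longleftrightarrow> (\<exists>a. cond_a F \<delta> a \<and> cond_b F c a)" .
next
  fix a
  assume "cond_a F \<delta> a"
  then show "right_end F = \<infinity>"
    using assms(4) by (intro cond_a_right_end) auto
qed

end
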